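(* For every integer $n\ge 3$, $$N(n,n-2)=\frac{n!}{2}.$$
   Context: $B_n=2^{[n]}$ is the Boolean lattice of all subsets of $[n]=\{1,\dots,n\}$ ordered by inclusion. A chain is a set of pairwise comparable elements; a chain $C$ covers a chain $D$ if $D\subseteq C$. For $1\le r\le n+1$, $N(n,r)$ is the least number of chains in $B_n$ such that every strict chain $F_1\subset F_2\subset\cdots\subset F_r$ of size $r$ in $B_n$ is covered by at least one of them. *)

theory Defs
  imports Complex_Main
begin

definition boolean_lattice :: "nat \<Rightarrow> nat set set" where
  "boolean_lattice n = Pow {1..n}"

definition is_chain :: "nat \<Rightarrow> nat set set \<Rightarrow> bool" where
  "is_chain n C \<longleftrightarrow> C \<subseteq> boolean_lattice n \<and> (\<forall>A\<in>C. \<forall>B\<in>C. A \<subseteq> B \<or> B \<subseteq> A)"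

(* A strict chain F_1 < ... < F_r is given by its set of members, a chain of cardinality r. *)
definition covers_r_chains :: "nat \<Rightarrow> nat \<Rightarrow> nat set set set \<Rightarrow> bool" where
  "covers_r_chains n r \<C> \<longleftrightarrow>
     (\<forall>C\<in>\<C>. is_chain n C) \<and>
     (\<forall>D. is_chain n D \<and> card D = r \<longrightarrow> (\<exists>C\<in>\<C>. D \<subseteq> C))"

(* The LEAST is never vacuous: for each r the (finite) family of all chains is a candidate. *)
definition N :: "nat \<Rightarrow> nat \<Rightarrow> nat" where
  "N n r = (LEAST k. \<exists>\<C>. finite \<C> \<and> card \<C> = k \<and> covers_r_chains n r \<C>)"

end

theory Submission
  imports Defs "HOL-Algebra.Sym_Groups"
begin

text \<open>
  A permutation \<open>p\<close> of \<open>{1..n}\<close> is the same thing as the maximal chain of its prefix sets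
  \<open>p ` {1..k}\<close> with \<open>k \<le> n\<close>, and composing \<open>p\<close> on the right with the transposition of
  \<open>i\<close> and \<open>i + 1\<close> alters that chain on level \<open>i\<close> only. Both bounds are the order
  \<open>n! / 2\<close> of the alternating group, and both rest on the fact that such a transposition is odd.

  Upper bound: the maximal chains of the even permutations suffice. A chain \<open>D\<close> with \<open>n - 2\<close>
  members extends to the maximal chain of some permutation \<open>p\<close>. Since \<open>D\<close> meets fewer than
  \<open>n - 1\<close> levels, it misses some level \<open>i\<close> strictly between \<open>0\<close> and \<open>n\<close>, and so \<open>p\<close>
  may be replaced by its product with the transposition of \<open>i\<close> and \<open>i + 1\<close>; one of the
  two permutations is even (\<open>even_permutation_through_chain\<close>).

  Lower bound: consider the prefix sets of an even permutation on the \<open>n - 2\<close> levels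
  \<open>2, \<dots>, n - 1\<close> only. They determine the permutation up to exchanging its first two values,
  hence determine it completely among the even ones (\<open>even_permutation_determined\<close>). As a
  chain has at most one member on each level, different even permutations need different
  covering chains.
\<close>

section \<open>Chains and the prefix sets of a permutation\<close>

lemma chain_eq_of_card_eq:
  assumes "is_chain n C" "A \<in> C" "B \<in> C" "card A = card B"
  shows "A = B"
proof -
  have "finite A" "finite B"
    using assms by (auto simp: is_chain_def boolean_lattice_def intro: finite_subset)
  moreover have "A \<subseteq> B \<or> B \<subseteq> A"
    using assms by (auto simp: is_chain_def)
  ultimately show ?thesis
    using assms(4) card_subset_eq by metis
qed

lemma card_prefix:
  fixes p :: "nat \<Rightarrow> nat"
  assumes "p permutes S"
  shows "card (p ` {1..k}) = k"
  using assms by (simp add: card_image inj_on_subset[OF permutes_inj])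

lemma is_chain_prefixes:
  assumes "p permutes {1..n}" "K \<subseteq> {0..n}"
  shows "is_chain n ((\<lambda>k. p ` {1..k}) ` K)"
proof -
  have "p ` {1..k} \<subseteq> {1..n}" if "k \<in> K" for k
  proof -
    have "{1..k} \<subseteq> {1..n}"
      using that assms(2) by auto
    then show ?thesis
      using permutes_image[OF assms(1)] by blast
  qed
  moreover have "p ` {1..k} \<subseteq> p ` {1..l} \<or> p ` {1..l} \<subseteq> p ` {1..k}" for k l
    using nat_le_linear[of k l] by (auto simp: image_iff)
  ultimately show ?thesis
    unfolding is_chain_def boolean_lattice_def by blast
qed

text \<open>
  The enumeration is built from the top: the members of \<open>D\<close> other than \<open>S\<close> itself, if there
  are any, have a largest one, so they all avoid some point of \<open>S\<close>, which can be listed last.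
\<close>

lemma chain_has_compatible_enumeration:
  assumes "finite S" "card S = n" "D \<subseteq> Pow S" "\<forall>A\<in>D. \<forall>B\<in>D. A \<subseteq> B \<or> B \<subseteq> A"
  shows "\<exists>p. bij_betw p {1..n} S \<and> (\<forall>F\<in>D. F = p ` {1..card F})"
  using assms
proof (induction n arbitrary: S D)
  case 0
  then have "S = {}" "D \<subseteq> {{}}"
    by auto
  have "bij_betw p {1..0} S" for p :: "nat \<Rightarrow> 'a"
    using \<open>S = {}\<close> by (simp add: bij_betw_def)
  moreover have "F = p ` {1..card F}" if "F \<in> D" for F and p :: "nat \<Rightarrow> 'a"
  proof -
    have "F = {}"
      using that \<open>D \<subseteq> {{}}\<close> by blast
    then show ?thesis
      by simp
  qed
  ultimately show ?case
    by blast
next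
  case (Suc n)
  have "finite (D - {S})"
    using Suc.prems by (meson finite_Diff finite_Pow_iff finite_subset)
  have "\<exists>x\<in>S. x \<notin> \<Union>(D - {S})"
  proof (cases "D - {S} = {}")
    case True
    then show ?thesis
      using Suc.prems(2) by (metis Sup_empty all_not_in_conv card.empty nat.distinct(1))
  next
    case False
    have "subset.chain UNIV (D - {S})"
      using Suc.prems(4) by (auto simp: subset_chain_def)
    then have "\<Union>(D - {S}) \<in> D - {S}"
      using False \<open>finite (D - {S})\<close> by (intro Union_in_chain)
    then show ?thesis
      using Suc.prems(3) by blast
  qed
  then obtain x where x: "x \<in> S" "x \<notin> \<Union>(D - {S})"
    by blast
  have "\<exists>p. bij_betw p {1..n} (S - {x}) \<and> (\<forall>F\<in>D - {S}. F = p ` {1..card F})"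
  proof (rule Suc.IH)
    show "finite (S - {x})" "card (S - {x}) = n"
      using Suc.prems(1,2) x(1) by simp_all
    show "D - {S} \<subseteq> Pow (S - {x})"
      using Suc.prems(3) x(2) by blast
    show "\<forall>A\<in>D - {S}. \<forall>B\<in>D - {S}. A \<subseteq> B \<or> B \<subseteq> A"
      using Suc.prems(4) by simp
  qed
  then obtain p where p: "bij_betw p {1..n} (S - {x})" "\<forall>F\<in>D - {S}. F = p ` {1..card F}"
    by (elim exE conjE)
  define q where "q = p(Suc n := x)"
  have "bij_betw q {1..n} (S - {x})"
    using p(1) by (subst bij_betw_cong[of _ _ p]) (auto simp: q_def)
  then have "bij_betw q ({1..n} \<union> {Suc n}) ((S - {x}) \<union> {q (Suc n)})"
    by (intro notIn_Un_bij_betw) (auto simp: q_def)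
  moreover have "{1..n} \<union> {Suc n} = {1..Suc n}" "(S - {x}) \<union> {q (Suc n)} = S"
    using x(1) by (auto simp: q_def)
  ultimately have q: "bij_betw q {1..Suc n} S"
    by simp
  have "F = q ` {1..card F}" if "F \<in> D" for F
  proof (cases "F = S")
    case True
    then show ?thesis
      using q Suc.prems(2) by (simp add: bij_betw_def)
  next
    case False
    then have "F \<subseteq> S - {x}"
      using that x(2) Suc.prems(3) by blast
    then have "card F \<le> n"
      using card_mono[of "S - {x}" F] Suc.prems(1,2) x(1) by simp
    then have "q ` {1..card F} = p ` {1..card F}"
      by (intro image_cong) (auto simp: q_def)
    moreover have "F = p ` {1..card F}"
      using p(2) that False by blast
    ultimately show ?thesis
      by (rule ssubst)
  qed
  with q show ?case
    by blast
qed

section \<open>Extending a chain to the maximal chain of an even permutation\<close>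

lemma prefix_compose_transpose:
  fixes p :: "nat \<Rightarrow> nat"
  assumes "k \<noteq> i" "i \<ge> 1"
  shows "(p \<circ> transpose i (Suc i)) ` {1..k} = p ` {1..k}"
proof -
  have "transpose i (Suc i) ` {1..k} = {1..k}"
  proof (cases "k < i")
    case True
    then have "transpose i (Suc i) ` {1..k} = id ` {1..k}"
      by (intro image_cong) (auto simp: transpose_def)
    then show ?thesis
      by simp
  next
    case False
    then have "transpose i (Suc i) permutes {1..k}"
      using assms by (intro permutes_swap_id) auto
    then show ?thesis
      by (rule permutes_image)
  qed
  then show ?thesis
    by (simp only: image_comp[symmetric])
qed

text \<open>
  A compatible permutation of the wrong parity is corrected at a level that the chain leaves free;
  such an inner level exists because there are \<open>n - 1\<close> of them.
\<close>

lemma even_permutation_through_chain: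
  assumes "is_chain n D" "card D < n - 1"
  shows "\<exists>p. p permutes {1..n} \<and> evenperm p \<and> D \<subseteq> (\<lambda>k. p ` {1..k}) ` {0..n}"
proof -
  have D: "D \<subseteq> Pow {1..n}" "\<forall>A\<in>D. \<forall>B\<in>D. A \<subseteq> B \<or> B \<subseteq> A"
    using assms(1) by (auto simp: is_chain_def boolean_lattice_def)
  obtain e where e: "bij_betw e {1..n} {1..n}" "\<forall>F\<in>D. F = e ` {1..card F}"
    using chain_has_compatible_enumeration[of "{1..n}" n D] D by auto
  have level: "card F \<le> n" if "F \<in> D" for F
    using that D(1) card_mono[of "{1..n}" F] by auto
  define p where "p x = (if x \<in> {1..n} then e x else x)" for x
  have "bij_betw p {1..n} {1..n}"
    using e(1) by (subst bij_betw_cong[of _ _ e]) (auto simp: p_def)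
  then have p: "p permutes {1..n}"
    by (intro bij_imp_permutes) (auto simp: p_def)
  have pD: "F = p ` {1..card F}" if "F \<in> D" for F
  proof -
    have "p ` {1..card F} = e ` {1..card F}"
      using level[OF that] by (intro image_cong) (auto simp: p_def)
    then show ?thesis
      using e(2) that by simp
  qed
  have through: "D \<subseteq> (\<lambda>k. q ` {1..k}) ` {0..n}" if "\<And>F. F \<in> D \<Longrightarrow> F = q ` {1..card F}" for q
  proof
    fix F assume "F \<in> D"
    then show "F \<in> (\<lambda>k. q ` {1..k}) ` {0..n}"
      using that[of F] level[of F] by (intro image_eqI[where x = "card F"]) auto
  qed
  have "finite D"
    using D(1) by (meson finite_Pow_iff finite_atLeastAtMost finite_subset)
  then have "card (card ` D) < card {1..n - 1}"
    using card_image_le[of D card] assms(2) by simp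
  then have "\<not> {1..n - 1} \<subseteq> card ` D"
    using card_mono[of "card ` D" "{1..n - 1}"] \<open>finite D\<close> by fastforce
  then obtain i where i: "i \<in> {1..n - 1}" "i \<notin> card ` D"
    by blast
  define q where "q = p \<circ> transpose i (Suc i)"
  have t: "transpose i (Suc i) permutes {1..n}"
    using i(1) by (intro permutes_swap_id) auto
  have q: "q permutes {1..n}"
    unfolding q_def using t p by (rule permutes_compose)
  have "F = q ` {1..card F}" if "F \<in> D" for F
  proof -
    have "card F \<noteq> i"
      using i(2) that by blast
    then have "q ` {1..card F} = p ` {1..card F}"
      unfolding q_def using i(1) by (intro prefix_compose_transpose) auto
    then show ?thesis
      using pD that by simp
  qed
  then have "D \<subseteq> (\<lambda>k. q ` {1..k}) ` {0..n}"
    by (rule through)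
  moreover have "D \<subseteq> (\<lambda>k. p ` {1..k}) ` {0..n}"
    using pD by (rule through)
  moreover have "evenperm q \<longleftrightarrow> \<not> evenperm p"
    unfolding q_def using p t
    by (subst evenperm_comp) (auto simp: evenperm_swap permutation_swap_id permutation_permutes)
  ultimately show ?thesis
    using p q by blast
qed

section \<open>Even permutations with the same prefix sets from level 2 on\<close>

text \<open>
  The quotient \<open>inv' q \<circ> p\<close> preserves every initial segment of length at least \<open>2\<close>. Hence it
  fixes everything beyond \<open>2\<close> and, being even, also \<open>1\<close> and \<open>2\<close>.
\<close>

lemma even_permutation_determined:
  fixes p q :: "nat \<Rightarrow> nat"
  assumes p: "p permutes {1..n}" "evenperm p" and q: "q permutes {1..n}" "evenperm q"
    and eq: "\<And>k. k \<in> {2..n - 1} \<Longrightarrow> p ` {1..k} = q ` {1..k}"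
  shows "p = q"
proof -
  define r where "r = inv' q \<circ> p"
  have r: "r permutes {1..n}"
    unfolding r_def using p(1) permutes_inv[OF q(1)] by (rule permutes_compose)
  have r_seg: "r ` {1..k} = {1..k}" if "k \<in> {2..n}" for k
  proof (cases "k = n")
    case True
    then show ?thesis
      using permutes_image[OF r] by simp
  next
    case False
    then have "p ` {1..k} = q ` {1..k}"
      using that by (intro eq) auto
    then have "r ` {1..k} = inv' q ` q ` {1..k}"
      unfolding r_def image_comp[symmetric] by simp
    then show ?thesis
      using permutes_inj[OF q(1)] by (simp add: image_inv_f_f)
  qed
  have "r permutes {1, 2}"
  proof (rule permutes_superset[OF r])
    fix k assume "k \<in> {1..n} - {1, 2}"
    then have k: "k \<in> {2..n}" "k - 1 \<in> {2..n}" and seg: "{1..k} - {1..k - 1} = {k}"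
      by auto
    have "r ` {k} = r ` {1..k} - r ` {1..k - 1}"
      unfolding seg[symmetric] by (rule image_set_diff[OF permutes_inj[OF r]])
    also have "\<dots> = {k}"
      using r_seg[OF k(1)] r_seg[OF k(2)] seg by simp
    finally show "r k = k"
      by simp
  qed
  then have "r = id \<or> r = transpose 1 2"
    by (simp add: permutes_doubleton_iff)
  moreover have "permutation p" "permutation q"
    using p(1) q(1) by (auto simp: permutation_permutes)
  then have "evenperm r"
    unfolding r_def using p(2) q(2) by (simp add: evenperm_comp evenperm_inv permutation_inverse)
  ultimately have "inv' q \<circ> p = id"
    by (auto simp: evenperm_swap r_def)
  then have "q \<circ> (inv' q \<circ> p) = q"
    by simp
  then show ?thesis
    by (simp add: comp_assoc[symmetric] permutes_inv_o[OF q(1)])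
qed

section \<open>Coverings and the alternating group\<close>

lemma card_even_permutations:
  assumes "n \<ge> 2"
  shows "2 * card {p. p permutes {1..n} \<and> evenperm p} = fact n"
  using alt_group_card_carrier[OF assms] by (simp add: alt_group_def)

lemma covered_by_even_permutations:
  assumes "n \<ge> 3"
  shows "covers_r_chains n (n - 2)
    ((\<lambda>p. (\<lambda>k. p ` {1..k}) ` {0..n}) ` {p. p permutes {1..n} \<and> evenperm p})"
  unfolding covers_r_chains_def
proof (intro conjI ballI allI impI)
  fix C assume "C \<in> (\<lambda>p. (\<lambda>k. p ` {1..k}) ` {0..n}) ` {p. p permutes {1..n} \<and> evenperm p}"
  then show "is_chain n C"
    using is_chain_prefixes by blast
next
  fix D assume "is_chain n D \<and> card D = n - 2"
  then show "\<exists>C\<in>(\<lambda>p. (\<lambda>k. p ` {1..k}) ` {0..n}) ` {p. p permutes {1..n} \<and> evenperm p}. D \<subseteq> C"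
    using even_permutation_through_chain[of n D] assms by auto
qed

lemma even_permutations_le_covering:
  assumes "n \<ge> 3" "finite \<C>" and cov: "covers_r_chains n (n - 2) \<C>"
  shows "card {p. p permutes {1..n} \<and> evenperm p} \<le> card \<C>"
proof -
  define D where "D p = (\<lambda>k. p ` {1..k}) ` {2..n - 1}" for p :: "nat \<Rightarrow> nat"
  have "\<exists>C\<in>\<C>. D p \<subseteq> C" if "p permutes {1..n}" for p
  proof -
    have "is_chain n (D p)"
      unfolding D_def using that by (intro is_chain_prefixes) auto
    moreover have "inj_on (\<lambda>k. p ` {1..k}) {2..n - 1}"
      using card_prefix[OF that] by (intro inj_onI) metis
    then have "card (D p) = n - 2"
      unfolding D_def using assms(1) by (simp add: card_image)
    ultimately show ?thesis
      using cov by (simp add: covers_r_chains_def)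
  qed
  then obtain f where f: "\<And>p. p permutes {1..n} \<Longrightarrow> f p \<in> \<C> \<and> D p \<subseteq> f p"
    by metis
  have "inj_on f {p. p permutes {1..n} \<and> evenperm p}"
  proof (rule inj_onI, clarify)
    fix p q assume p: "p permutes {1..n}" "evenperm p" and q: "q permutes {1..n}" "evenperm q"
      and "f p = f q"
    show "p = q"
    proof (rule even_permutation_determined[OF p q])
      fix k assume "k \<in> {2..n - 1}"
      then have "p ` {1..k} \<in> f p" "q ` {1..k} \<in> f p"
        using f[OF p(1)] f[OF q(1)] \<open>f p = f q\<close> by (auto simp: D_def)
      moreover have "is_chain n (f p)"
        using f[OF p(1)] cov by (simp add: covers_r_chains_def)
      ultimately show "p ` {1..k} = q ` {1..k}"
        using card_prefix[OF p(1)] card_prefix[OF q(1)] by (intro chain_eq_of_card_eq) auto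
    qed
  qed
  moreover have "f ` {p. p permutes {1..n} \<and> evenperm p} \<subseteq> \<C>"
    using f by blast
  ultimately show ?thesis
    using card_inj_on_le \<open>finite \<C>\<close> by blast
qed

theorem proposition1p6:
  fixes n :: nat
  assumes "n \<ge> 3"
  shows "real (N n (n - 2)) = fact n / 2"
proof -
  let ?E = "{p. p permutes {1..n} \<and> evenperm p}"
  let ?F = "(\<lambda>p. (\<lambda>k. p ` {1..k}) ` {0..n}) ` ?E"
  have "finite ?E"
    by (rule finite_subset[OF _ finite_permutations[of "{1..n}"]]) auto
  have F: "finite ?F" "covers_r_chains n (n - 2) ?F"
    using \<open>finite ?E\<close> covered_by_even_permutations[OF assms] by auto
  have "card ?F = card ?E"
    using card_image_le[OF \<open>finite ?E\<close>] even_permutations_le_covering[OF assms F]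
    by (rule le_antisym)
  then have "N n (n - 2) = card ?E"
    unfolding N_def using F even_permutations_le_covering[OF assms]
    by (intro Least_equality) blast+
  moreover have "2 * card ?E = fact n"
    using assms by (intro card_even_permutations) simp
  then have "2 * real (card ?E) = fact n"
    by (metis of_nat_fact of_nat_mult of_nat_numeral)
  ultimately show ?thesis
    by simp
qed

end
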